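(* Let $q=2^m$ with $m\ge 3$ and let $n=q+4$. Then there exists a $q$-ary Singleton-optimal locally repairable code of length $n=q+4$, minimum distance $d=6$ and locality $r=3$ with disjoint repair groups.
   Context: Codes are linear: an $[n,k,d]_q$ code $C$ is a $k$-dimensional subspace of $\mathbb{F}_q^n$ ($k\ge 1$) with minimum Hamming distance $d$; $C^\perp$ is its dual code. $C$ is a locally repairable code (LRC) with locality $r$ if for every coordinate $i\in[n]=\{1,\dots,n\}$ there is a codeword $\bm h\in C^\perp$ with $i\in\mathrm{supp}(\bm h)$ and Hamming weight at most $r+1$. When $(r+1)\mid n$, $C$ has disjoint repair groups if there are $\ell=n/(r+1)$ codewords $\bm h_1,\dots,\bm h_\ell\in C^\perp$, each of Hamming weight exactly $r+1$, with pairwise disjoint supports (so the supports partition $[n]$). Every such LRC satisfies the Singleton-type bound $d\le n-k-\lceil k/r\rceil+2$; $C$ is called Singleton-optimal if equality holds. For $d=6$, $r=3$, $4\mid n$ this is equivalent to $n-k=n/4+3$. *)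

theory Defs
  imports "HOL-Analysis.Analysis"
begin

text \<open>
  A word of length n over the field \<open>'a\<close> is a vector in \<open>'a ^ 'n\<close> with \<open>CARD('n) = n\<close>;
  the index type \<open>'n\<close> plays the role of \<open>{1..n}\<close>.
\<close>

definition supp :: "'a::zero ^ 'n \<Rightarrow> 'n set" where
  "supp x = {i. x $ i \<noteq> 0}"

definition hamming_weight :: "'a::zero ^ 'n::finite \<Rightarrow> nat" where
  "hamming_weight x = card (supp x)"

definition hamming_dist :: "'a ^ 'n::finite \<Rightarrow> 'a ^ 'n \<Rightarrow> nat" where
  "hamming_dist x y = card {i. x $ i \<noteq> y $ i}"

text \<open>Only meaningful if \<open>C\<close> has at least two elements, since \<open>Min {}\<close> is unspecified.\<close>

definition min_dist :: "('a ^ 'n::finite) set \<Rightarrow> nat" where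
  "min_dist C = Min {hamming_dist x y | x y. x \<in> C \<and> y \<in> C \<and> x \<noteq> y}"

definition linear_code :: "nat \<Rightarrow> nat \<Rightarrow> ('a::{field,finite} ^ 'n::finite) set \<Rightarrow> bool" where
  "linear_code k d C \<longleftrightarrow> vec.subspace C \<and> vec.dim C = k \<and> 1 \<le> k \<and> min_dist C = d"

definition dual_code :: "('a::field ^ 'n::finite) set \<Rightarrow> ('a ^ 'n) set" where
  "dual_code C = {h. \<forall>c\<in>C. scalar_product h c = 0}"

definition has_locality :: "nat \<Rightarrow> ('a::field ^ 'n::finite) set \<Rightarrow> bool" where
  "has_locality r C \<longleftrightarrow>
     (\<forall>i. \<exists>h\<in>dual_code C. i \<in> supp h \<and> hamming_weight h \<le> r + 1)"

definition disjoint_repair_groups :: "nat \<Rightarrow> ('a::field ^ 'n::finite) set \<Rightarrow> bool" where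
  "disjoint_repair_groups r C \<longleftrightarrow>
     (r + 1) dvd CARD('n) \<and>
     (\<exists>h :: nat \<Rightarrow> 'a ^ 'n.
        (\<forall>j\<in>{1..CARD('n) div (r + 1)}. h j \<in> dual_code C \<and> hamming_weight (h j) = r + 1) \<and>
        disjoint_family_on (\<lambda>j. supp (h j)) {1..CARD('n) div (r + 1)})"

text \<open>Equality in the Singleton-type bound; over the integers to avoid truncated subtraction.\<close>

definition singleton_optimal :: "nat \<Rightarrow> ('a::field ^ 'n::finite) set \<Rightarrow> bool" where
  "singleton_optimal r C \<longleftrightarrow>
     int (min_dist C) =
       int CARD('n) - int (vec.dim C) - \<lceil>real (vec.dim C) / real r\<rceil> + 2"

end

(*
  Points of PG(2,q) are distributed over groups of four such that any three collinear points
  lie in three different groups. A codeword attaches to every group g a vector w_g with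
  sum_g w_g = 0, and has the entry <p, w_g> at the point p of g. Nonzero w_g leave at least two
  nonzero entries in their group; if only two of them are nonzero, then w_g = -w_h and the line
  w_g contains at most two of the eight points of the groups g and h. In both cases the weight
  is at least 6.

  The points are (t, t^2) for t in F_q and (a, a^2 + c) for a in A, where A = {0, 1, b, b + 1} is
  an additive subgroup; the groups are the cosets of A on the parabola and the shifted copy of A.
  What is needed is that x^2 + s x + c has no root for s in A - {0}, and a character sum over the
  index-two subgroup {x^2 + x} shows that suitable b and c exist once q >= 8.
*)
theory Submission
  imports Defs
begin

section \<open>Preliminaries\<close>

lemma scalar_product_add_right:
  "scalar_product u (v + w) = scalar_product u v + scalar_product u (w :: 'a::comm_ring_1 ^ 'n)"
  by (simp add: scalar_product_def distrib_left sum.distrib)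

lemma scalar_product_minus_right:
  "scalar_product u (- w) = - scalar_product u (w :: 'a::comm_ring_1 ^ 'n)"
  by (simp add: scalar_product_def sum_negf)

lemma scalar_product_diff_right:
  "scalar_product u (v - w) = scalar_product u v - scalar_product u (w :: 'a::comm_ring_1 ^ 'n)"
  by (simp add: scalar_product_def right_diff_distrib sum_subtractf)

lemma scalar_product_scale_right:
  "scalar_product u (a *s w) = a * scalar_product u (w :: 'a::comm_ring_1 ^ 'n)"
  by (simp add: scalar_product_def sum_distrib_left mult_ac)

lemma scalar_product_0_right [simp]: "scalar_product u (0 :: 'a::comm_ring_1 ^ 'n) = 0"
  by (simp add: scalar_product_def)

lemma scalar_product_0_left [simp]: "scalar_product 0 (u :: 'a::comm_ring_1 ^ 'n) = 0"
  by (simp add: scalar_product_def)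

lemma scalar_product_sum_left:
  "scalar_product (sum f I) (w :: 'a::comm_ring_1 ^ 'n) = (\<Sum>i\<in>I. scalar_product (f i) w)"
proof -
  have "scalar_product (sum f I) w = (\<Sum>j\<in>UNIV. \<Sum>i\<in>I. f i $ j * w $ j)"
    by (simp add: scalar_product_def sum_distrib_right)
  also have "\<dots> = (\<Sum>i\<in>I. scalar_product (f i) w)"
    unfolding scalar_product_def by (rule sum.swap)
  finally show ?thesis .
qed

lemma hamming_dist_eq_weight:
  "hamming_dist x y = hamming_weight (x - y :: 'a::ab_group_add ^ 'n)"
  by (simp add: hamming_dist_def hamming_weight_def supp_def)

section \<open>Cardinalities of subspaces and of zero-sum families\<close>

lemma card_span_independent:
  fixes B :: "('a::{field,finite} ^ 'n::finite) set"
  assumes "vec.independent B"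
  shows "card (vec.span B) = CARD('a) ^ card B"
proof -
  have "finite B" by simp
  then show ?thesis using assms
  proof (induction B rule: finite_induct)
    case empty
    then show ?case by simp
  next
    case (insert b B)
    have b: "b \<notin> vec.span B" and B: "vec.independent B"
      using insert.prems insert.hyps by (simp_all add: vec.independent_insert)
    \<comment> \<open>Each vector of the larger span is \<open>k *s b + y\<close> for a unique pair,
      because \<open>b\<close> lies outside the span of \<open>B\<close>.\<close>
    have "bij_betw (\<lambda>(k, y). k *s b + y) (UNIV \<times> vec.span B) (vec.span (insert b B))"
    proof (rule bij_betw_imageI)
      show "inj_on (\<lambda>(k, y). k *s b + y) (UNIV \<times> vec.span B)"
      proof (rule inj_onI, clarsimp)
        fix k k' :: 'a and y y'
        assume y: "y \<in> vec.span B" "y' \<in> vec.span B" and eq: "k *s b + y = k' *s b + y'"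
        have "(k - k') *s b = y' - y"
          using eq by (simp add: vec.scale_left_diff_distrib algebra_simps)
        then have "(k - k') *s b \<in> vec.span B" using y by (simp add: vec.span_diff)
        then have "k = k'"
          using b vec.span_scale[of "(k - k') *s b" B "inverse (k - k')"]
          by (cases "k = k'") (simp_all only: vec.scale_scale, simp)
        then show "k = k' \<and> y = y'" using eq by simp
      qed
      show "(\<lambda>(k, y). k *s b + y) ` (UNIV \<times> vec.span B) = vec.span (insert b B)"
      proof (intro set_eqI iffI)
        fix x assume "x \<in> vec.span (insert b B)"
        then obtain k where "x - k *s b \<in> vec.span B" by (auto simp: vec.span_insert)
        then show "x \<in> (\<lambda>(k, y). k *s b + y) ` (UNIV \<times> vec.span B)"
          by (intro image_eqI[of _ _ "(k, x - k *s b)"]) auto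
      next
        fix x assume "x \<in> (\<lambda>(k, y). k *s b + y) ` (UNIV \<times> vec.span B)"
        then obtain k y where "x = k *s b + y" "y \<in> vec.span B" by auto
        then show "x \<in> vec.span (insert b B)"
          unfolding vec.span_insert by (intro CollectI exI[of _ k]) simp
      qed
    qed
    then have "card (vec.span (insert b B)) = CARD('a) * card (vec.span B)"
      by (metis bij_betw_same_card card_cartesian_product)
    then show ?case using insert.IH[OF B] insert.hyps by simp
  qed
qed

text \<open>Lets the dimension of the code be read off from the number of codewords.\<close>

lemma card_subspace:
  fixes S :: "('a::{field,finite} ^ 'n::finite) set"
  assumes "vec.subspace S"
  shows "card S = CARD('a) ^ vec.dim S"
proof -
  obtain B where "B \<subseteq> S" "vec.independent B" "S \<subseteq> vec.span B" "card B = vec.dim S"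
    by (rule vec.basis_exists)
  moreover from this have "vec.span B = S"
    using assms by (simp add: vec.span_subspace)
  ultimately show ?thesis using card_span_independent by metis
qed

text \<open>The value at one index \<open>i\<close> is minus the sum of the others, so restriction
  to the remaining indices is a bijection.\<close>

lemma card_PiE_sum_eq_0:
  fixes I :: "'i set"
  assumes "finite I" "I \<noteq> {}"
  shows "card {w \<in> I \<rightarrow>\<^sub>E (UNIV :: 'b::{ab_group_add,finite} set). sum w I = 0}
         = CARD('b) ^ (card I - 1)"
proof -
  obtain i where i: "i \<in> I" using assms by blast
  let ?J = "I - {i}"
  let ?W = "{w \<in> I \<rightarrow>\<^sub>E (UNIV :: 'b set). sum w I = 0}"
  have I: "I = insert i ?J" "i \<notin> ?J" "finite ?J" using i assms by auto
  have sum_I: "sum w I = w i + sum w ?J" for w :: "'i \<Rightarrow> 'b"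
    using assms i by (simp add: sum.remove)
  have "bij_betw (\<lambda>w. restrict w ?J) ?W (?J \<rightarrow>\<^sub>E UNIV)"
  proof (rule bij_betw_byWitness[where f' = "\<lambda>u. u(i := - sum u ?J)"])
    show "\<forall>w\<in>?W. (restrict w ?J)(i := - sum (restrict w ?J) ?J) = w"
    proof (intro ballI ext)
      fix w x assume w: "w \<in> ?W"
      then have "w i = - sum w ?J" using sum_I[of w] by (simp add: eq_neg_iff_add_eq_0)
      then show "((restrict w ?J)(i := - sum (restrict w ?J) ?J)) x = w x"
        using w by (auto simp: PiE_def extensional_def)
    qed
    show "\<forall>u\<in>?J \<rightarrow>\<^sub>E UNIV. restrict (u(i := - sum u ?J)) ?J = u"
      by (auto simp: PiE_def extensional_def fun_eq_iff)
    show "(\<lambda>w. restrict w ?J) ` ?W \<subseteq> ?J \<rightarrow>\<^sub>E UNIV" by auto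
    show "(\<lambda>u. u(i := - sum u ?J)) ` (?J \<rightarrow>\<^sub>E UNIV) \<subseteq> ?W"
    proof clarify
      fix u :: "'i \<Rightarrow> 'b" assume u: "u \<in> ?J \<rightarrow>\<^sub>E UNIV"
      have "sum (u(i := - sum u ?J)) ?J = sum u ?J" by (rule sum.cong) auto
      then show "u(i := - sum u ?J) \<in> I \<rightarrow>\<^sub>E UNIV \<and> sum (u(i := - sum u ?J)) I = 0"
        using u i sum_I[of "u(i := - sum u ?J)"] by (auto simp: PiE_def extensional_def)
    qed
  qed
  then have "card ?W = card (?J \<rightarrow>\<^sub>E (UNIV :: 'b set))" by (rule bij_betw_same_card)
  also have "\<dots> = CARD('b) ^ (card I - 1)" using assms i by (simp add: card_funcsetE)
  finally show ?thesis .
qed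

section \<open>Codes from quadrangles\<close>

text \<open>
  A nonzero \<open>w\<close> is a line of the projective plane: \<open>collinear\<close> says that three collinear points
  lie in three different groups.
\<close>

locale quadrangle_partition =
  fixes p :: "'n::finite \<Rightarrow> 'a::{field,finite} ^ 3" and grp :: "'n \<Rightarrow> 'g"
  assumes card_group: "card {j. grp j = grp i} = 4"
    and sum_group: "(\<Sum>j | grp j = grp i. p j) = 0"
    and collinear: "\<lbrakk>i \<noteq> j; i \<noteq> k; j \<noteq> k; grp i = grp j; scalar_product (p i) w = 0;
      scalar_product (p j) w = 0; scalar_product (p k) w = 0\<rbrakk> \<Longrightarrow> w = 0"
    and two_groups: "\<exists>i j. grp i \<noteq> grp j"
begin

definition word :: "('g \<Rightarrow> 'a ^ 3) \<Rightarrow> 'a ^ 'n" where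
  "word w = (\<chi> i. scalar_product (p i) (w (grp i)))"

text \<open>The type \<open>'g\<close> may be infinite, but \<open>word w\<close> depends only on
  the values of \<open>w\<close> on \<open>range grp\<close>; hence the zero-sum condition runs over
  that finite set.\<close>

definition code :: "('a ^ 'n) set" where
  "code = word ` {w. sum w (range grp) = 0}"

section \<open>Weights of codewords\<close>

lemma card_zeros_le:
  assumes "w \<noteq> 0"
  shows "card {i. grp i \<in> {g, h} \<and> scalar_product (p i) w = 0} \<le> 2"
proof (rule ccontr)
  let ?Z = "{i. grp i \<in> {g, h} \<and> scalar_product (p i) w = 0}"
  assume "\<not> ?thesis"
  then have "3 \<le> card ?Z" by simp
  then obtain T where T: "T \<subseteq> ?Z" "card T = 3" by (rule obtain_subset_with_card_n)
  then obtain x y z where "T = {x, y, z}" "x \<noteq> y" "y \<noteq> z" "x \<noteq> z"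
    unfolding card_3_iff by blast
  moreover from this T have "grp x \<in> {g, h}" "grp y \<in> {g, h}" "grp z \<in> {g, h}"
    "scalar_product (p x) w = 0" "scalar_product (p y) w = 0" "scalar_product (p z) w = 0"
    by auto
  \<comment> \<open>Two of the three points share a group; the three instances of
    \<open>collinear\<close> cover the possible pairs.\<close>
  ultimately show False
    using collinear[of x y z w] collinear[of x z y w] collinear[of y z x w] assms by auto
qed

text \<open>The case \<open>g = h\<close> of \<open>card_zeros_le\<close> leaves at most two zeros
  among four points.\<close>

lemma card_nonzeros_one:
  assumes "w \<noteq> 0" "g \<in> range grp"
  shows "2 \<le> card {i. grp i = g \<and> scalar_product (p i) w \<noteq> 0}"
proof -
  let ?N = "{i. grp i = g \<and> scalar_product (p i) w \<noteq> 0}"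
  let ?Z = "{i. grp i \<in> {g, g} \<and> scalar_product (p i) w = 0}"
  have "{i. grp i = g} = ?N \<union> ?Z" by auto
  then have "card {i. grp i = g} \<le> card ?N + card ?Z" by (simp only: card_Un_le)
  moreover have "card {i. grp i = g} = 4" using assms(2) card_group by auto
  ultimately show ?thesis using card_zeros_le[OF assms(1), of g g] by linarith
qed

text \<open>Turns an upper bound on zeros into a lower bound on the weight, and for the codeword of
  weight 6 a lower bound on zeros into an upper bound.\<close>

lemma card_nonzeros_two:
  assumes "g \<in> range grp" "h \<in> range grp" "g \<noteq> h"
  shows "card {i. grp i \<in> {g, h} \<and> scalar_product (p i) w \<noteq> 0}
         + card {i. grp i \<in> {g, h} \<and> scalar_product (p i) w = 0} = 8"
proof -
  have "card {i. grp i \<in> {g, h} \<and> scalar_product (p i) w \<noteq> 0}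
      + card {i. grp i \<in> {g, h} \<and> scalar_product (p i) w = 0} = card {i. grp i \<in> {g, h}}"
    by (subst card_Un_disjoint[symmetric]) (auto intro: arg_cong[where f = card])
  also have "{i. grp i \<in> {g, h}} = {i. grp i = g} \<union> {i. grp i = h}" by auto
  also have "card \<dots> = 8"
    using assms card_group by (subst card_Un_disjoint) fastforce+
  finally show ?thesis .
qed

text \<open>A nonzero vector at \<open>g\<close> would leave two nonzero entries there. By
  linearity, a codeword thus determines its vectors on \<open>range grp\<close>.\<close>

lemma word_eq_0D:
  assumes "word w = 0" "g \<in> range grp"
  shows "w g = 0"
proof (rule ccontr)
  assume "w g \<noteq> 0"
  moreover have "scalar_product (p i) (w (grp i)) = 0" for i
    using assms(1) by (simp add: word_def vec_eq_iff)
  then have "card {i. grp i = g \<and> scalar_product (p i) (w g) \<noteq> 0} = 0" by auto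
  ultimately show False using card_nonzeros_one[of "w g" g] assms(2) by linarith
qed

lemma weight_word_ge:
  assumes sum: "sum w (range grp) = 0" and nz: "word w \<noteq> 0"
  shows "6 \<le> hamming_weight (word w)"
proof -
  define S where "S = {g \<in> range grp. w g \<noteq> 0}"
  define P where "P = (\<lambda>g. {i. grp i = g \<and> scalar_product (p i) (w g) \<noteq> 0})"
  have sum_S: "sum w S = 0"
    using sum unfolding S_def by (subst sum.mono_neutral_left[of "range grp"]) auto
  have "S \<noteq> {}"
  proof -
    obtain i where "scalar_product (p i) (w (grp i)) \<noteq> 0"
      using nz by (auto simp: word_def vec_eq_iff)
    then have "w (grp i) \<noteq> 0" by auto
    then show ?thesis by (auto simp: S_def)
  qed
  \<comment> \<open>A single nonzero vector cannot sum to zero.\<close>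
  moreover have "card S \<noteq> 1"
    using sum_S by (auto simp: card_1_singleton_iff S_def)
  moreover have fin: "finite S" by (simp add: S_def)
  ultimately consider "card S = 2" | "3 \<le> card S"
    by (metis One_nat_def Suc_1 card_gt_0_iff le_less_linear less_2_cases less_antisym
        less_irrefl numeral_3_eq_3)
  then show ?thesis
  proof cases
    case 1
    then obtain g h where gh: "S = {g, h}" "g \<noteq> h" by (metis card_2_iff)
    \<comment> \<open>Both groups see the same line, so its at most two zeros are counted among all
      eight points.\<close>
    then have w: "w h = - w g" using sum_S by (simp add: eq_neg_iff_add_eq_0 add.commute)
    have g: "g \<in> range grp" "h \<in> range grp" "w g \<noteq> 0" using gh by (auto simp: S_def)
    have "6 \<le> card {i. grp i \<in> {g, h} \<and> scalar_product (p i) (w g) \<noteq> 0}"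
      using card_nonzeros_two[OF g(1,2) gh(2), of "w g"] card_zeros_le[OF g(3), of g h] by linarith
    also have "\<dots> \<le> hamming_weight (word w)"
      unfolding hamming_weight_def
      by (rule card_mono) (use w in \<open>auto simp: supp_def word_def scalar_product_minus_right\<close>)
    finally show ?thesis .
  next
    case 2
    have "2 * card S \<le> (\<Sum>g\<in>S. card (P g))"
      using sum_mono[of S "\<lambda>_. 2" "\<lambda>g. card (P g)"] card_nonzeros_one
      by (auto simp: S_def P_def)
    also have "\<dots> = card (\<Union>g\<in>S. P g)"
      using fin by (subst card_UN_disjoint) (auto simp: P_def)
    also have "\<dots> \<le> hamming_weight (word w)"
      unfolding hamming_weight_def by (rule card_mono) (auto simp: supp_def word_def P_def)
    finally show ?thesis using 2 by linarith
  qed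
qed

text \<open>Take a line \<open>w\<close> through two points of group \<open>g\<close> and put
  \<open>w\<close> on \<open>g\<close>, \<open>- w\<close> on \<open>h\<close>. At least two of the
  eight entries vanish, and \<open>weight_word_ge\<close> excludes a smaller weight.\<close>

lemma exists_weight_6: "\<exists>x\<in>code. x \<noteq> 0 \<and> hamming_weight x = 6"
proof -
  obtain i0 j0 where ij0: "grp i0 \<noteq> grp j0" using two_groups by blast
  define g h where "g = grp i0" and "h = grp j0"
  have gh: "g \<in> range grp" "h \<in> range grp" "g \<noteq> h" using ij0 by (auto simp: g_def h_def)
  have "2 \<le> card {i. grp i = g}" using card_group[of i0] by (simp add: g_def)
  then obtain T where "T \<subseteq> {i. grp i = g}" "card T = 2" by (rule obtain_subset_with_card_n)
  then obtain i j where ij: "i \<noteq> j" "grp i = g" "grp j = g" by (auto simp: card_2_iff)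
  let ?e = "\<lambda>w. (scalar_product (p i) w, scalar_product (p j) w)"
  have "CARD('a) > 1"
    using card_mono[of UNIV "{0, 1 :: 'a}"] by simp
  \<comment> \<open>Pigeonhole: \<open>?e\<close> maps \<open>'a ^ 3\<close> to pairs, so two
    vectors have the same image, and their difference is the desired line.\<close>
  then have "CARD('a) ^ 2 < CARD('a) ^ 3" by (intro power_strict_increasing) auto
  moreover have "card (range ?e) \<le> CARD('a \<times> 'a)" by (intro card_mono) auto
  ultimately have "card (range ?e) < CARD('a ^ 3)" by (simp add: power2_eq_square)
  then have "\<not> inj ?e" using card_image[of ?e UNIV] by (metis less_irrefl)
  then obtain u v where uv: "u \<noteq> v" "?e u = ?e v" by (auto simp: inj_def)
  define w where "w = u - v"
  have w: "w \<noteq> 0" "scalar_product (p i) w = 0" "scalar_product (p j) w = 0"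
    using uv by (auto simp: w_def scalar_product_diff_right)
  define f where "f = (\<lambda>x. if x = g then w else if x = h then - w else 0)"
  have "sum f (range grp) = sum f {g, h}"
    by (rule sum.mono_neutral_right) (use gh in \<open>auto simp: f_def\<close>)
  also have "\<dots> = 0" using gh by (simp add: f_def)
  finally have f0: "sum f (range grp) = 0" .
  have nz: "word f \<noteq> 0" using word_eq_0D[OF _ gh(1), of f] w by (auto simp: f_def)
  have "card {i, j} \<le> card {i. grp i \<in> {g, h} \<and> scalar_product (p i) w = 0}"
    by (rule card_mono) (use ij w in auto)
  then have "card {i. grp i \<in> {g, h} \<and> scalar_product (p i) w \<noteq> 0} \<le> 6"
    using card_nonzeros_two[OF gh, of w] ij by simp
  moreover have "supp (word f) = {i. grp i \<in> {g, h} \<and> scalar_product (p i) w \<noteq> 0}"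
    by (auto simp: supp_def word_def f_def scalar_product_minus_right)
  ultimately have "hamming_weight (word f) = 6"
    using weight_word_ge[OF f0 nz] by (simp add: hamming_weight_def)
  then show ?thesis using nz f0 by (auto simp: code_def)
qed

section \<open>Linearity, minimum distance, dimension and length\<close>

lemma subspace_code: "vec.subspace code"
proof (rule vec.subspaceI)
  have "word (\<lambda>_. 0) = 0" by (simp add: word_def vec_eq_iff)
  then show "0 \<in> code" unfolding code_def by (intro image_eqI[of _ _ "\<lambda>_. 0"]) auto
next
  fix x y assume "x \<in> code" "y \<in> code"
  then obtain v w where "x = word v" "y = word w" "sum v (range grp) = 0" "sum w (range grp) = 0"
    by (auto simp: code_def)
  then show "x + y \<in> code" unfolding code_def
    by (intro image_eqI[of _ _ "\<lambda>g. v g + w g"])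
      (simp_all add: word_def vec_eq_iff scalar_product_add_right sum.distrib)
next
  fix c x assume "x \<in> code"
  then obtain w where "x = word w" "sum w (range grp) = 0" by (auto simp: code_def)
  then show "c *s x \<in> code" unfolding code_def
    by (intro image_eqI[of _ _ "\<lambda>g. c *s w g"])
      (simp_all add: word_def vec_eq_iff scalar_product_scale_right flip: sum_distrib_left)
qed

lemma min_dist_code: "min_dist code = 6"
  unfolding min_dist_def
proof (rule Min_eqI)
  show "finite {hamming_dist x y |x y. x \<in> code \<and> y \<in> code \<and> x \<noteq> y}"
    by (rule finite_subset[of _ "(\<lambda>(x, y). hamming_dist x y) ` UNIV"]) auto
next
  fix d assume "d \<in> {hamming_dist x y |x y. x \<in> code \<and> y \<in> code \<and> x \<noteq> y}"
  then obtain x y where xy: "x \<in> code" "y \<in> code" "x \<noteq> y" "d = hamming_dist x y" by blast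
  then have "x - y \<in> code" using subspace_code by (auto simp: vec.subspace_diff)
  then obtain w where "x - y = word w" "sum w (range grp) = 0" by (auto simp: code_def)
  moreover from this xy have "word w \<noteq> 0" by auto
  ultimately show "6 \<le> d" using weight_word_ge[of w] xy(4) by (simp add: hamming_dist_eq_weight)
next
  obtain x where "x \<in> code" "x \<noteq> 0" "hamming_weight x = 6" using exists_weight_6 by blast
  moreover have "0 \<in> code" using subspace_code by (rule vec.subspace_0)
  ultimately show "6 \<in> {hamming_dist x y |x y. x \<in> code \<and> y \<in> code \<and> x \<noteq> y}"
    by (intro CollectI exI[of _ x] exI[of _ 0]) (simp add: hamming_dist_eq_weight)
qed

text \<open>Zero-sum families restricted to \<open>range grp\<close> correspond bijectively to
  codewords; counting both sides as powers of \<open>CARD('a)\<close> gives the dimension.\<close>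

lemma dim_code: "vec.dim code = 3 * (card (range grp) - 1)"
proof -
  let ?W = "{w \<in> range grp \<rightarrow>\<^sub>E (UNIV :: ('a ^ 3) set). sum w (range grp) = 0}"
  have "inj_on word ?W"
  proof (rule inj_onI)
    fix v w assume v: "v \<in> ?W" and w: "w \<in> ?W" and eq: "word v = word w"
    have "word (\<lambda>g. v g - w g) = 0"
      using eq by (simp add: word_def vec_eq_iff scalar_product_diff_right)
    then have "\<And>g. g \<in> range grp \<Longrightarrow> v g = w g"
      using word_eq_0D by fastforce
    then show "v = w" using v w by (auto intro: PiE_ext)
  qed
  moreover have "word ` ?W = code"
  proof
    show "code \<subseteq> word ` ?W"
    proof
      fix x assume "x \<in> code"
      then obtain w where "x = word w" "sum w (range grp) = 0" by (auto simp: code_def)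
      then show "x \<in> word ` ?W"
        by (intro image_eqI[of _ _ "restrict w (range grp)"]) (auto simp: word_def)
    qed
  qed (auto simp: code_def)
  ultimately have "card code = card ?W" using card_image[of word ?W] by argo
  also have "\<dots> = CARD('a ^ 3) ^ (card (range grp) - 1)"
    by (rule card_PiE_sum_eq_0) auto
  finally have "CARD('a) ^ vec.dim code = CARD('a) ^ (3 * (card (range grp) - 1))"
    by (simp add: card_subspace[OF subspace_code] power_mult)
  moreover have "CARD('a) > 1"
    using card_mono[of UNIV "{0, 1 :: 'a}"] by simp
  ultimately show ?thesis by simp
qed

lemma card_positions: "CARD('n) = 4 * card (range grp)"
proof -
  have "CARD('n) = card (\<Union>g\<in>range grp. {i. grp i = g})"
    by (rule arg_cong[where f = card]) auto
  also have "\<dots> = (\<Sum>g\<in>range grp. card {i. grp i = g})"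
    by (rule card_UN_disjoint) auto
  also have "\<dots> = (\<Sum>g\<in>range grp. 4)"
    by (rule sum.cong) (use card_group in auto)
  finally show ?thesis by simp
qed

lemma card_groups_ge: "2 \<le> card (range grp)"
proof -
  obtain i j where "grp i \<noteq> grp j" using two_groups by blast
  then show ?thesis using card_mono[of "range grp" "{grp i, grp j}"] by simp
qed

section \<open>Repair groups from indicator vectors\<close>

lemma group_indicator_in_dual:
  assumes "g \<in> range grp"
  shows "(\<chi> i. if grp i = g then 1 else 0) \<in> dual_code code"
proof -
  have "scalar_product (\<chi> i. if grp i = g then 1 else 0) (word w) = 0" for w
  proof -
    have "scalar_product (\<chi> i. if grp i = g then 1 else 0) (word w)
        = (\<Sum>i\<in>UNIV. if grp i = g then scalar_product (p i) (w g) else 0)"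
      unfolding scalar_product_def[of "\<chi> i. if grp i = g then 1 else 0"]
      by (rule sum.cong) (auto simp: word_def)
    also have "\<dots> = (\<Sum>i | grp i = g. scalar_product (p i) (w g))"
      by (simp add: sum.If_cases)
    \<comment> \<open>The entries in one group add up to the product of \<open>w g\<close> with the
      sum of its points, which is zero.\<close>
    also have "\<dots> = scalar_product (\<Sum>i | grp i = g. p i) (w g)"
      by (simp add: scalar_product_sum_left)
    also have "\<dots> = 0" using sum_group assms by force
    finally show ?thesis .
  qed
  then show ?thesis by (auto simp: dual_code_def code_def)
qed

lemma supp_group_indicator: "supp (\<chi> i. if grp i = g then 1 else (0 :: 'a)) = {i. grp i = g}"
  by (auto simp: supp_def)

lemma weight_group_indicator:
  assumes "g \<in> range grp"
  shows "hamming_weight (\<chi> i. if grp i = g then 1 else (0 :: 'a)) = 4"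
  using assms card_group by (auto simp: hamming_weight_def supp_group_indicator)

lemma has_locality_code: "has_locality 3 code"
  unfolding has_locality_def
proof
  fix i
  show "\<exists>h\<in>dual_code code. i \<in> supp h \<and> hamming_weight h \<le> 3 + 1"
    using group_indicator_in_dual[of "grp i"] weight_group_indicator[of "grp i"]
    by (intro bexI[of _ "\<chi> j. if grp j = grp i then 1 else 0"])
      (auto simp: supp_group_indicator)
qed

lemma disjoint_repair_groups_code: "disjoint_repair_groups 3 code"
proof -
  obtain e where e: "bij_betw e {1..card (range grp)} (range grp)"
    using ex_bij_betw_nat_finite_1[of "range grp"] by auto
  let ?h = "\<lambda>j. \<chi> i. if grp i = e j then 1 else (0 :: 'a)"
  have "e j \<in> range grp" if "j \<in> {1..card (range grp)}" for j
    using bij_betwE[OF e] that by blast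
  then have "\<forall>j\<in>{1..card (range grp)}. ?h j \<in> dual_code code \<and> hamming_weight (?h j) = 3 + 1"
    using group_indicator_in_dual weight_group_indicator by simp
  moreover have "disjoint_family_on (\<lambda>j. supp (?h j)) {1..card (range grp)}"
    unfolding disjoint_family_on_def supp_group_indicator
  proof (intro ballI impI)
    fix j k assume "j \<in> {1..card (range grp)}" "k \<in> {1..card (range grp)}" "j \<noteq> k"
    then have "e j \<noteq> e k" using bij_betw_imp_inj_on[OF e] by (blast dest: inj_onD)
    then show "{i. grp i = e j} \<inter> {i. grp i = e k} = {}" by force
  qed
  moreover have "(3 + 1) dvd CARD('n)" "CARD('n) div (3 + 1) = card (range grp)"
    unfolding card_positions by simp_all
  ultimately show ?thesis
    unfolding disjoint_repair_groups_def by (intro conjI exI[of _ ?h]) simp_all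
qed

lemma code_properties:
  "linear_code (3 * (card (range grp) - 1)) 6 code \<and> has_locality 3 code \<and>
   disjoint_repair_groups 3 code \<and> singleton_optimal 3 code"
proof -
  have "linear_code (3 * (card (range grp) - 1)) 6 code"
    using subspace_code dim_code min_dist_code card_groups_ge by (simp add: linear_code_def)
  \<comment> \<open>With \<open>l + 1\<close> groups, the length is \<open>4 * l + 4\<close>, the
    dimension \<open>3 * l\<close> and the ceiling \<open>l\<close>, so the bound equals 6.\<close>
  moreover obtain l where "card (range grp) = Suc l"
    using card_groups_ge by (cases "card (range grp)") auto
  then have "singleton_optimal 3 code"
    by (simp add: singleton_optimal_def min_dist_code dim_code card_positions)
  ultimately show ?thesis using has_locality_code disjoint_repair_groups_code by blast
qed

end

section \<open>Quadratic polynomials in characteristic two\<close>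

text \<open>Translation by 1 permutes the field; comparing the sums of all elements shows that the
  field's cardinality is zero in the field.\<close>

lemma two_eq_0_of_card:
  assumes "CARD('a::{field,finite}) = 2 ^ m"
  shows "(2::'a) = 0"
proof -
  have "(\<Sum>x\<in>UNIV. x + 1) = (\<Sum>x\<in>UNIV. x :: 'a)"
    by (rule sum.reindex_bij_witness[of _ "\<lambda>x. x - 1" "\<lambda>x. x + 1"]) auto
  then have "of_nat CARD('a) = (0::'a)" by (simp add: sum.distrib)
  then show ?thesis using assms by simp
qed

text \<open>Reduces an identity in characteristic two to a plain ring identity, with
  \<open>k\<close> half the difference of the two sides.\<close>

lemma eq_modulo_two:
  fixes x y k :: "'a::field"
  assumes "(2::'a) = 0" "x = y + 2 * k"
  shows "x = y"
  using assms by simp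

lemma minus_eq_self_of_two_eq_0:
  fixes x :: "'a::field"
  assumes "(2::'a) = 0"
  shows "- x = x"
proof -
  have "x + x = 2 * x" by simp
  also have "\<dots> = 0" by (simp add: assms)
  finally show ?thesis by (simp add: eq_neg_iff_add_eq_0 neg_eq_iff_add_eq_0)
qed

lemma eq_of_add_eq_0_char_2:
  fixes x y :: "'a::field"
  assumes "(2::'a) = 0" "x + y = 0"
  shows "x = y"
proof -
  have "x = - y" using assms(2) by (simp only: eq_neg_iff_add_eq_0)
  then show ?thesis using minus_eq_self_of_two_eq_0[OF assms(1)] by simp
qed

section \<open>The Artin-Schreier subgroup and its character\<close>

context
  fixes H :: "'a::{field,finite} set"
  assumes two: "(2::'a) = 0"
  defines "H \<equiv> range (\<lambda>x. x\<^sup>2 + x)"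
begin

lemma add_self: "x + x = (0::'a)"
  using minus_eq_self_of_two_eq_0[OF two, of x] by (simp add: neg_eq_iff_add_eq_0)

lemma square_add: "(x + y)\<^sup>2 = x\<^sup>2 + (y::'a)\<^sup>2"
  by (simp add: power2_sum two)

lemma artin_schreier_add: "x \<in> H \<Longrightarrow> y \<in> H \<Longrightarrow> x + y \<in> H"
  unfolding H_def
proof clarify
  fix a b :: 'a
  show "a\<^sup>2 + a + (b\<^sup>2 + b) \<in> range (\<lambda>x. x\<^sup>2 + x)"
    by (rule range_eqI[of _ _ "a + b"]) (simp add: square_add algebra_simps)
qed

text \<open>The map \<open>x\<^sup>2 + x\<close> is additive with kernel \<open>{0, 1}\<close>,
  hence two-to-one onto \<open>H\<close>.\<close>

lemma card_artin_schreier: "2 * card H = CARD('a)"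
proof -
  have fibre: "card {x. x\<^sup>2 + x = h} = 2" if h: "h \<in> H" for h
  proof -
    obtain a where a: "h = a\<^sup>2 + a" using h by (auto simp: H_def)
    have "{x. x\<^sup>2 + x = h} = {a, a + 1}"
    proof (intro set_eqI iffI)
      fix x assume "x \<in> {x. x\<^sup>2 + x = h}"
      then have "x\<^sup>2 + x - (a\<^sup>2 + a) = 0" using a by simp
      then have "(x - a) * (x + a + 1) = 0" by (simp add: algebra_simps power2_eq_square)
      then have "x = a \<or> x + (a + 1) = 0" by (simp add: add.assoc)
      then show "x \<in> {a, a + 1}" using eq_of_add_eq_0_char_2[OF two, of x "a + 1"] by blast
    next
      fix x assume "x \<in> {a, a + 1}"
      moreover have "(a + 1)\<^sup>2 + (a + 1) = a\<^sup>2 + a + (1 + 1)"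
        by (simp only: square_add) (simp add: algebra_simps)
      ultimately show "x \<in> {x. x\<^sup>2 + x = h}" using a add_self[of 1] by auto
    qed
    then show ?thesis by simp
  qed
  have "CARD('a) = card (\<Union>h\<in>H. {x. x\<^sup>2 + x = h})"
    by (rule arg_cong[where f = card]) (auto simp: H_def)
  also have "\<dots> = (\<Sum>h\<in>H. card {x. x\<^sup>2 + x = h})"
    by (rule card_UN_disjoint) auto
  finally show ?thesis using fibre by simp
qed

text \<open>Since \<open>H\<close> has index two, its complement is a single coset, and two
  nonmembers sum to a member.\<close>

lemma artin_schreier_add_iff: "x + y \<in> H \<longleftrightarrow> (x \<in> H \<longleftrightarrow> y \<in> H)"
proof -
  have cancel: "x + (x + y) = y" for x y :: 'a
    using add_self[of x] by (simp flip: add.assoc)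
  have *: "x + y \<notin> H" if "x \<in> H" "y \<notin> H" for x y
    using artin_schreier_add[of x "x + y"] that by (auto simp: cancel)
  have "x + y \<in> H" if xy: "x \<notin> H" "y \<notin> H" for x y
  proof -
    have inj: "inj_on ((+) x) H" by simp
    have "(+) x ` H \<inter> H = {}" using *[of _ x] xy by (auto simp: add.commute)
    then have "card ((+) x ` H \<union> H) = 2 * card H"
      by (subst card_Un_disjoint) (auto simp: card_image[OF inj])
    then have "(+) x ` H \<union> H = UNIV" using card_artin_schreier by (simp add: card_eq_UNIV_imp_eq_UNIV)
    then obtain h where "h \<in> H" "y = x + h" using xy(2) by blast
    then show ?thesis by (simp add: cancel)
  qed
  then show ?thesis using *[of x y] *[of y x] artin_schreier_add[of x y]
    by (auto simp: add.commute)
qed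

text \<open>The additive character with kernel \<open>H\<close>, not the multiplicative quadratic
  character.\<close>

definition quad_char :: "'a \<Rightarrow> int" where
  "quad_char x = (if x \<in> H then 1 else - 1)"

lemma quad_char_add: "quad_char (x + y) = quad_char x * quad_char y"
  by (simp add: quad_char_def artin_schreier_add_iff)

text \<open>Scaling by \<open>y\<close> permutes the field, and the values 1 and -1 are taken
  equally often.\<close>

lemma sum_quad_char_mult:
  assumes "y \<noteq> 0"
  shows "(\<Sum>c\<in>UNIV. quad_char (c * y)) = 0"
proof -
  have "(\<Sum>c\<in>UNIV. quad_char (c * y)) = (\<Sum>c\<in>UNIV. quad_char c)"
    by (rule sum.reindex_bij_witness[of _ "\<lambda>x. x / y" "\<lambda>x. x * y"]) (use assms in auto)
  also have "\<dots> = int (card H) - int (card (- H))"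
    by (simp add: quad_char_def sum.If_cases)
  also have "card (- H) = card H"
    using card_artin_schreier card_Un_disjoint[of H "- H"] by simp
  finally show ?thesis by simp
qed

text \<open>
  Summing \<open>(1 - \<chi>(c y1)) (1 - \<chi>(c y2)) (1 - \<chi>(c y3))\<close> over \<open>c\<close> leaves only the constant
  term, so some summand is nonzero.
\<close>

lemma exists_simultaneous_nonmember:
  assumes "y1 \<noteq> 0" "y2 \<noteq> 0" "y3 \<noteq> 0" "y1 + y2 \<noteq> 0" "y1 + y3 \<noteq> 0" "y2 + y3 \<noteq> 0"
    "y1 + y2 + y3 \<noteq> 0"
  shows "\<exists>c. c * y1 \<notin> H \<and> c * y2 \<notin> H \<and> c * y3 \<notin> H"
proof (rule ccontr)
  let ?e = "\<lambda>y c. quad_char (c * y)"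
  assume "\<not> ?thesis"
  then have "(1 - ?e y1 c) * (1 - ?e y2 c) * (1 - ?e y3 c) = 0" for c
    by (auto simp: quad_char_def)
  \<comment> \<open>The arguments of the nonconstant terms are multiples of the seven sums assumed
    nonzero, so each such term sums to zero over \<open>c\<close>.\<close>
  moreover have "(1 - ?e y1 c) * (1 - ?e y2 c) * (1 - ?e y3 c)
      = 1 - ?e y1 c - ?e y2 c - ?e y3 c + ?e (y1 + y2) c + ?e (y1 + y3) c + ?e (y2 + y3) c
        - ?e (y1 + y2 + y3) c" for c
    by (simp add: distrib_left quad_char_add) (simp add: algebra_simps)
  ultimately have "(\<Sum>c\<in>UNIV. 1 - ?e y1 c - ?e y2 c - ?e y3 c + ?e (y1 + y2) c + ?e (y1 + y3) c
      + ?e (y2 + y3) c - ?e (y1 + y2 + y3) c) = 0"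
    by simp
  then show False
    using assms by (simp add: sum.distrib sum_subtractf sum_quad_char_mult)
qed

text \<open>Substituting \<open>x = s * z\<close> and dividing by the square of \<open>s\<close>
  shows that rootlessness means \<open>c * inverse s ^ 2\<close> is outside \<open>H\<close>. The
  character sum applies once the three values \<open>inverse s ^ 2\<close> are linearly independent
  over the prime field.\<close>

lemma exists_rootless_quadratics:
  assumes "CARD('a) \<ge> 8"
  shows "\<exists>b c :: 'a. b \<noteq> 0 \<and> b \<noteq> 1 \<and> (\<forall>s\<in>{1, b, b + 1}. \<forall>x. x\<^sup>2 + s * x + c \<noteq> 0)"
proof -
  note eq = eq_of_add_eq_0_char_2[OF two]
  \<comment> \<open>A value of \<open>b\<^sup>2 + b\<close> other than 0 keeps \<open>b\<close> away
    from 0 and 1; a value other than 1 makes the sum of all three inverses nonzero.\<close>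
  have "card {0, 1 :: 'a} < card H" using card_artin_schreier assms by simp
  then have "\<not> H \<subseteq> {0, 1}" using card_mono[of "{0, 1 :: 'a}" H] by auto
  then obtain b :: 'a where b: "b\<^sup>2 + b \<noteq> 0" "b\<^sup>2 + b \<noteq> 1" unfolding H_def by blast
  have b01: "b \<noteq> 0" "b \<noteq> 1" using b(1) add_self[of 1] by auto
  have b1: "b + 1 \<noteq> 0" using eq b01 by blast
  define y where "y = (\<lambda>s::'a. inverse s ^ 2)"
  have y_nz: "y s \<noteq> 0" if "s \<noteq> 0" for s using that by (simp add: y_def)
  have y_add: "y s + y t \<noteq> 0" if "s \<noteq> t" for s t
  proof -
    have "inverse s + inverse t \<noteq> 0" using that eq[of "inverse s" "inverse t"] by auto
    moreover have "y s + y t = (inverse s + inverse t)\<^sup>2" by (simp add: y_def square_add)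
    ultimately show ?thesis by simp
  qed
  have "inverse 1 + inverse b + inverse (b + 1) = (b\<^sup>2 + b + 1 + (b + b)) / (b * (b + 1))"
    using b01 b1 by (simp add: field_simps power2_eq_square)
  also have "\<dots> \<noteq> 0"
    using b01 b1 b(2) eq[of "b\<^sup>2 + b" 1] add_self[of b] by auto
  finally have "(inverse 1 + inverse b + inverse (b + 1))\<^sup>2 \<noteq> 0" by simp
  then have sum3: "y 1 + y b + y (b + 1) \<noteq> 0" by (simp only: y_def square_add) simp
  have "\<exists>c. c * y 1 \<notin> H \<and> c * y b \<notin> H \<and> c * y (b + 1) \<notin> H"
    by (rule exists_simultaneous_nonmember)
      (use b01 b1 sum3 in \<open>auto intro!: y_add y_nz\<close>)
  then obtain c where c: "c * y s \<notin> H" if "s \<in> {1, b, b + 1}" for s by auto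
  have "x\<^sup>2 + s * x + c \<noteq> 0" if s: "s \<in> {1, b, b + 1}" for s x
  proof
    assume "x\<^sup>2 + s * x + c = 0"
    then have "c = x\<^sup>2 + s * x" using eq by force
    moreover have "s \<noteq> 0" using s b01 b1 by auto
    ultimately have "c * y s = (x / s)\<^sup>2 + x / s"
      by (simp add: y_def field_simps power2_eq_square)
    then show False using c[OF s] by (auto simp: H_def)
  qed
  then show ?thesis using b01 by blast
qed

end

section \<open>The parabola and its shift\<close>

text \<open>Homogeneous coordinates of the affine point with abscissa \<open>t\<close> on the
  parabola shifted by \<open>e\<close>. The first coordinate 1 makes four such vectors cancel
  there.\<close>

definition parabola_point :: "'a::field \<times> 'a \<Rightarrow> 'a ^ 3" where
  "parabola_point = (\<lambda>(t, e). vector [1, t, t\<^sup>2 + e])"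

lemma scalar_product_parabola_point:
  "scalar_product (parabola_point (t, e)) w = w $ 1 + t * w $ 2 + (t\<^sup>2 + e) * w $ 3"
  by (simp add: parabola_point_def scalar_product_def sum_3)

text \<open>
  The line through \<open>(t, e)\<close> and \<open>(u, e)\<close> is \<open>y = s x + \<dots>\<close> with slope \<open>s = t + u\<close>; it meets the
  parabola shifted by \<open>e'\<close> in the roots \<open>v\<close> of \<open>(v + t)\<^sup>2 + s (v + t) + (e + e')\<close>.
\<close>

lemma parabola_points_collinear:
  fixes w :: "'a::{field,finite} ^ 3"
  assumes two: "(2::'a) = 0"
    and rootless: "\<And>x. x\<^sup>2 + (t + u) * x + c \<noteq> 0"
    and ee: "e' = e \<or> e + e' = c"
    and ne: "t \<noteq> u" "(v, e') \<noteq> (t, e)" "(v, e') \<noteq> (u, e)"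
    and zero: "scalar_product (parabola_point (t, e)) w = 0"
      "scalar_product (parabola_point (u, e)) w = 0"
      "scalar_product (parabola_point (v, e')) w = 0"
  shows "w = 0"
proof -
  have z: "w $ 1 + t * w $ 2 + (t\<^sup>2 + e) * w $ 3 = 0" "w $ 1 + u * w $ 2 + (u\<^sup>2 + e) * w $ 3 = 0"
    "w $ 1 + v * w $ 2 + (v\<^sup>2 + e') * w $ 3 = 0"
    using zero by (simp_all add: scalar_product_parabola_point)
  have "(t - u) * (w $ 2 + (t + u) * w $ 3) = 0"
    using z(1,2) by algebra
  then have "w $ 2 + (t + u) * w $ 3 = 0" using ne(1) by simp
  then have w2: "w $ 2 = (t + u) * w $ 3" by (rule eq_of_add_eq_0_char_2[OF two])
  \<comment> \<open>Subtract the first equation from the third and eliminate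
    \<open>w $ 2\<close>.\<close>
  have "((v - t) * (v + t + (t + u)) + (e' - e)) * w $ 3 = 0"
    using z(1,3) w2 by algebra
  moreover have "(v - t) * (v + t + (t + u)) + (e' - e) = (v + t)\<^sup>2 + (t + u) * (v + t) + (e + e')"
    by (rule eq_modulo_two[OF two, of _ _ "- (v * t + 2 * t\<^sup>2 + t * u + e)"]) algebra
  moreover have "(v + t)\<^sup>2 + (t + u) * (v + t) + (e + e') \<noteq> 0"
  proof (cases "e' = e")
    case True
    then have "v - t \<noteq> 0" "v - u \<noteq> 0" using ne by auto
    \<comment> \<open>On the same parabola the line meets only the points with abscissas
      \<open>t\<close> and \<open>u\<close>.\<close>
    moreover have "(v + t)\<^sup>2 + (t + u) * (v + t) + (e + e') = (v - t) * (v - u)"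
      unfolding True by (rule eq_modulo_two[OF two, of _ _ "2 * v * t + t\<^sup>2 + u * v + e"]) algebra
    ultimately show ?thesis by simp
  next
    case False
    then show ?thesis using ee rootless[of "v + t"] by auto
  qed
  ultimately have w3: "w $ 3 = 0" by (metis mult_eq_0_iff)
  then show ?thesis using w2 z(1) by (simp add: vec_eq_iff forall_3)
qed

theorem theorem7:
  fixes m q :: nat
  assumes "m \<ge> 3"
    and "q = 2 ^ m"
    and "CARD('a::{field,finite}) = q"
    and "CARD('n::finite) = q + 4"
  shows "\<exists>(C :: ('a ^ 'n) set) k.
           linear_code k 6 C \<and> has_locality 3 C \<and>
           disjoint_repair_groups 3 C \<and> singleton_optimal 3 C"
proof -
  have two: "(2::'a) = 0" using two_eq_0_of_card assms by metis
  have "(2::nat) ^ 3 \<le> 2 ^ m" using assms(1) by (rule power_increasing) simp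
  then have q8: "CARD('a) \<ge> 8" using assms by simp
  obtain b c :: 'a where b: "b \<noteq> 0" "b \<noteq> 1"
    and rootless: "\<And>s x. s \<in> {1, b, b + 1} \<Longrightarrow> x\<^sup>2 + s * x + c \<noteq> 0"
    using exists_rootless_quadratics[OF two q8] by blast
  \<comment> \<open>Keeps the parabola and its shift disjoint.\<close>
  have c: "c \<noteq> 0" using rootless[of 1 0] by simp
  note eq = eq_of_add_eq_0_char_2[OF two]
  define A where "A = {0, 1, b, b + 1}"
  have b1: "b + 1 \<noteq> 0" using b eq[of b 1] by blast
  have cardA: "card A = 4" using b b1 by (auto simp: A_def card_insert_if)
  have xxy: "x + (x + y) = y" for x y :: 'a
    by (rule eq_modulo_two[OF two, of _ _ x]) simp
  have A_add: "x + y \<in> A" if "x \<in> A" "y \<in> A" for x y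
    using that add_self[OF two] by (auto simp: A_def ac_simps xxy)
  have coset_iff: "(+) t ` A = (+) u ` A \<longleftrightarrow> t + u \<in> A" for t u
  proof
    assume "(+) t ` A = (+) u ` A"
    moreover have "t \<in> (+) t ` A" by (rule image_eqI[of _ _ 0]) (auto simp: A_def)
    ultimately obtain a where "a \<in> A" "t = u + a" by blast
    then show "t + u \<in> A" by (simp add: ac_simps two)
  next
    have sub: "(+) t ` A \<subseteq> (+) u ` A" if "t + u \<in> A" for t u
    proof
      fix x assume "x \<in> (+) t ` A"
      then obtain a where a: "a \<in> A" "x = t + a" by blast
      have "u + ((t + u) + a) = t + a" by (rule eq_modulo_two[OF two, of _ _ u]) simp
      then have "x = u + ((t + u) + a)" using a by simp
      then show "x \<in> (+) u ` A" using A_add[OF that a(1)] by blast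
    qed
    assume "t + u \<in> A"
    then show "(+) t ` A = (+) u ` A" using sub[of t u] sub[of u t] by (simp add: add.commute)
  qed
  \<comment> \<open>The q points of the parabola and four of its shift, as pairs of abscissa and
    shift.\<close>
  define L where "L = UNIV \<times> {0} \<union> A \<times> {c}"
  have "card L = CARD('n)"
    unfolding L_def using c assms cardA
    by (subst card_Un_disjoint) (auto simp: card_cartesian_product)
  then obtain pos :: "'n \<Rightarrow> 'a \<times> 'a" where pos: "bij_betw pos UNIV L"
    by (metis finite_same_card_bij finite)
  have pos_L: "pos i \<in> L" for i using bij_betwE[OF pos] by blast
  have inj_pos: "inj pos" using bij_betw_imp_inj_on[OF pos] .
  \<comment> \<open>The coset and the shift label a group; the shifted points, with abscissas in
    \<open>A\<close>, form one group.\<close>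
  define lab where "lab = (\<lambda>(t::'a, e::'a). ((+) t ` A, e))"
  define grp where "grp = (\<lambda>i. lab (pos i))"
  define p where "p = (\<lambda>i. parabola_point (pos i))"
  have fibre: "pos ` {j. grp j = grp i} = (\<lambda>a. (t + a, e)) ` A" if "pos i = (t, e)" for i t e
  proof (intro set_eqI iffI)
    fix x assume "x \<in> pos ` {j. grp j = grp i}"
    then obtain j u e' where j: "x = pos j" "grp j = grp i" "pos j = (u, e')"
      by (metis (mono_tags, lifting) imageE mem_Collect_eq surj_pair)
    then have "e' = e" "u + t \<in> A" using that by (simp_all add: grp_def lab_def coset_iff)
    moreover have "u = t + (u + t)" by (simp add: two)
    ultimately show "x \<in> (\<lambda>a. (t + a, e)) ` A" using j by (intro image_eqI[of _ _ "u + t"]) auto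
  next
    fix x assume "x \<in> (\<lambda>a. (t + a, e)) ` A"
    then obtain a where a: "x = (t + a, e)" "a \<in> A" by blast
    \<comment> \<open>On the shifted copy \<open>t\<close> is in \<open>A\<close>, so closure of
      \<open>A\<close> under addition keeps the whole coset inside \<open>L\<close>.\<close>
    then have "x \<in> L" using pos_L[of i] that A_add by (auto simp: L_def)
    then obtain j where j: "x = pos j" using pos by (auto simp: bij_betw_def)
    then have "grp j = grp i" using a that j[symmetric]
      by (simp add: grp_def lab_def coset_iff two)
    then show "x \<in> pos ` {j. grp j = grp i}" using j by blast
  qed
  interpret quadrangle_partition p grp
  proof
    fix i
    obtain t e where te: "pos i = (t, e)" by fastforce
    have inj: "inj_on (\<lambda>a. (t + a, e)) A" by (auto simp: inj_on_def)
    have "card {j. grp j = grp i} = card (pos ` {j. grp j = grp i})"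
      by (rule card_image[symmetric]) (rule inj_on_subset[OF inj_pos], simp)
    then show "card {j. grp j = grp i} = 4" by (simp add: fibre[OF te] card_image[OF inj] cardA)
    have "(\<Sum>j | grp j = grp i. p j) = sum parabola_point (pos ` {j. grp j = grp i})"
      unfolding p_def
      by (subst sum.reindex) (auto intro: inj_on_subset[OF inj_pos])
    also have "\<dots> = (\<Sum>a\<in>A. parabola_point (t + a, e))"
      by (simp add: fibre[OF te] sum.reindex[OF inj])
    also have "\<dots> = parabola_point (t, e) + parabola_point (t + 1, e) + parabola_point (t + b, e)
        + parabola_point (t + (b + 1), e)"
      using b b1 by (simp add: A_def ac_simps)
    also have "\<dots> = 0"
    proof -
      \<comment> \<open>The elements of \<open>A\<close> sum to zero, and so do their squares, since
        squaring is additive.\<close>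
      have "1 + 1 + 1 + 1 = (0::'a)" by (rule eq_modulo_two[OF two, of _ _ 2]) simp
      moreover have "t + (t + 1) + (t + b) + (t + (b + 1)) = 0"
        by (rule eq_modulo_two[OF two, of _ _ "2 * t + b + 1"]) simp
      moreover have "t\<^sup>2 + e + ((t + 1)\<^sup>2 + e) + ((t + b)\<^sup>2 + e) + ((t + (b + 1))\<^sup>2 + e) = 0"
        by (rule eq_modulo_two[OF two, of _ _
              "2 * t\<^sup>2 + 2 * e + 2 * t + 2 * t * b + b\<^sup>2 + b + 1"]) algebra
      ultimately show ?thesis by (simp add: vec_eq_iff forall_3 parabola_point_def)
    qed
    finally show "(\<Sum>j | grp j = grp i. p j) = 0" .
  next
    fix i j k and w :: "'a ^ 3"
    assume ne: "i \<noteq> j" "i \<noteq> k" "j \<noteq> k" and g: "grp i = grp j"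
      and zero: "scalar_product (p i) w = 0" "scalar_product (p j) w = 0"
        "scalar_product (p k) w = 0"
    obtain t e u v e' where te: "pos i = (t, e)" "pos j = (u, e)" "pos k = (v, e')" "t + u \<in> A"
      using g by (cases "pos i"; cases "pos j"; cases "pos k") (auto simp: grp_def lab_def coset_iff)
    have "pos i \<noteq> pos j" "pos k \<noteq> pos i" "pos k \<noteq> pos j" using ne inj_pos by (auto dest: injD)
    then have d: "t \<noteq> u" "(v, e') \<noteq> (t, e)" "(v, e') \<noteq> (u, e)" using te by auto
    have "t + u \<noteq> 0" using d(1) eq[of t u] by blast
    then have s: "t + u \<in> {1, b, b + 1}" using te(4) by (auto simp: A_def)
    \<comment> \<open>Both shifts lie in \<open>{0, c}\<close>, so two different ones add up to
      \<open>c\<close>.\<close>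
    have "e' = e \<or> e + e' = c"
      using pos_L[of i] pos_L[of k] te by (auto simp: L_def)
    then show "w = 0"
      using parabola_points_collinear[OF two rootless[OF s] _ d] zero te by (simp add: p_def)
  next
    have "(0, 0) \<in> range pos" "(0, c) \<in> range pos"
      using bij_betw_imp_surj_on[OF pos] by (auto simp: L_def A_def)
    then obtain i j where "pos i = (0, 0)" "pos j = (0, c)" by (metis rangeE)
    then have "grp i \<noteq> grp j" using c by (simp add: grp_def lab_def)
    then show "\<exists>i j. grp i \<noteq> grp j" by blast
  qed
  show ?thesis using code_properties by blast
qed

end
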